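(* Let $\theta=(\theta_1,\theta_2)\in(0,\pi/2)\times(0,\pi/2)$. Let $\phi\in(0,\pi/2)$ be the first component of $\Theta_\phi^{-1}(\theta)$ (i.e. $\tan\phi=\tan\theta_2/\tan\theta_1$) and let $\psi\in(0,\pi/2)$ be the first component of $\Theta_\psi^{-1}(\theta)$ (i.e. $\tan\psi=\cot\theta_2/\tan\theta_1$). Suppose that $\mathbf{M}H_\phi^{-1}\mathbf{N}^{-1}$ and $M_1H_\psi^{-1}M_2^{-1}$ are both diagonalizable with all eigenvalues real and positive, with real matrices of right eigenvectors $V_\phi$ and $V_\psi$ respectively. Let $P_\phi=V_\phi V_\phi^\top$, $P_\psi=V_\psi V_\psi^\top$, $r=\|\mathbf{u}_{\mathrm A}-\mathbf{u}_{\mathrm N}\|_{P_\phi}$ and $r'=\|\mathbf{u}_1-\mathbf{u}_2\|_{P_\psi}$, and assume $r,r'>0$. Then the SVO-Nash equilibrium satisfies $$\mathbf{u}_\theta\in\mathcal{B}_\phi(\mathbf{u}_{\mathrm N},r)\cap\mathcal{B}_\phi(\mathbf{u}_{\mathrm A},r)\cap\mathcal{B}_\psi(\mathbf{u}_1,r')\cap\mathcal{B}_\psi(\mathbf{u}_2,r').$$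
   Context: Two-player quadratic game: $d_1,d_2\ge 1$, $d=d_1+d_2$, costs $J_i(u)=\tfrac12u^\top M_iu+c_i^\top u$ on $\mathbb{R}^{d_1}\times\mathbb{R}^{d_2}$, with symmetric real matrices $$M_1=\begin{bmatrix} A_1 & B_1^\top \\ B_1 & D_1 \end{bmatrix},\quad M_2=\begin{bmatrix} D_2 & B_2 \\ B_2^\top & A_2 \end{bmatrix},\quad c_1=\begin{bmatrix} a_1 \\ b_1 \end{bmatrix},\quad c_2=\begin{bmatrix} b_2 \\ a_2 \end{bmatrix},$$ where $A_1,D_2\in\mathbb{R}^{d_1\times d_1}$, $A_2,D_1\in\mathbb{R}^{d_2\times d_2}$, $B_1\in\mathbb{R}^{d_2\times d_1}$, $B_2\in\mathbb{R}^{d_1\times d_2}$, $a_1,b_2\in\mathbb{R}^{d_1}$, $a_2,b_1\in\mathbb{R}^{d_2}$. Put $$\mathbf{M}=\begin{bmatrix} A_1 & B_2 \\ B_1 & A_2 \end{bmatrix},\quad \mathbf{N}=\begin{bmatrix} D_2 & B_1^\top \\ B_2^\top & D_1 \end{bmatrix},\quad \mathbf{a}=\begin{bmatrix} a_1 \\ a_2 \end{bmatrix},\quad \mathbf{b}=\begin{bmatrix} b_2 \\ b_1 \end{bmatrix}.$$ Standing assumptions: $A_1,A_2\succ0$, and $M_1,M_2,\mathbf{M},\mathbf{N}$ are invertible. Define $\mathbf{u}_{\mathrm N}^\top=-\mathbf{a}^\top\mathbf{M}^{-1}$ (Nash), $\mathbf{u}_{\mathrm A}^\top=-\mathbf{b}^\top\mathbf{N}^{-1}$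 (altruistic Nash), $\mathbf{u}_i^\top=-c_i^\top M_i^{-1}$ (player $i$'s individual optimum). For social value orientations $\theta=(\theta_1,\theta_2)$ player $i$ uses the cost $\cos\theta_i\,J_i+\sin\theta_i\,J_{-i}$; the SVO-Nash equilibrium is $\mathbf{u}_\theta^\top=-s_\theta^\top S_\theta^{-1}$, where $$s_\theta=\begin{bmatrix}\cos\theta_1a_1+\sin\theta_1b_2 \\ \cos\theta_2a_2+\sin\theta_2b_1\end{bmatrix},\quad S_\theta=\begin{bmatrix}\cos\theta_1A_1+\sin\theta_1D_2 & \cos\theta_2B_2+\sin\theta_2B_1^\top \\ \cos\theta_1B_1+\sin\theta_1B_2^\top & \cos\theta_2A_2+\sin\theta_2D_1\end{bmatrix}$$ (under the hypotheses of the claim $S_\theta$ is invertible). The maps $\Theta_\phi(\phi,t)=(\arctan(t\cos\phi),\arctan(t\sin\phi))$ and $\Theta_\psi(\psi,t)=(\arctan(t\cos\psi),\operatorname{arccot}(t\sin\psi))$ are bijections from $(0,\pi/2)\times(0,\infty)$ to $(0,\pi/2)^2$. $H_\phi=\mathrm{blkdiag}(\cos\phi I_{d_1},\sin\phi I_{d_2})$ and $H_\psi=\mathrm{blkdiag}(\cos\psi I_{d_1},\sin\psi I_{d_2})$. For positive definite $P$, $\|u\|_P=(u^\top Pu)^{1/2}$; for $c\in\mathbb{R}^d$ and $\rho>0$, $\mathcal{B}_\phi(c,\rho)=\{u\in\mathbb{R}^d:\|u-c\|_{P_\phi}<\rho\}$ and $\mathcal{B}_\psi(c,\rho)=\{u\in\mathbb{R}^d:\|u-c\|_{P_\psi}<\rho\}$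 (open balls). *)

theory Defs
  imports "HOL-Analysis.Analysis"
begin

text \<open>
  The space of joint actions is \<open>real^('d1 + 'd2)\<close>: index \<open>Inl i\<close> is a coordinate of
  player 1's action, index \<open>Inr i\<close> one of player 2's. A matrix with \<open>p\<close> rows and \<open>q\<close>
  columns has type \<open>real^'q^'p\<close>.
\<close>

definition block_vec :: "'a^'d1 \<Rightarrow> 'a^'d2 \<Rightarrow> 'a^('d1 + 'd2)" where
  "block_vec x y = (\<chi> i. case i of Inl k \<Rightarrow> x $ k | Inr k \<Rightarrow> y $ k)"

definition block_mat ::
    "'a^'d1^'d1 \<Rightarrow> 'a^'d2^'d1 \<Rightarrow> 'a^'d1^'d2 \<Rightarrow> 'a^'d2^'d2 \<Rightarrow> 'a^('d1 + 'd2)^('d1 + 'd2)" where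
  "block_mat P Q R S =
     (\<chi> i. case i of Inl k \<Rightarrow> block_vec (P $ k) (Q $ k) | Inr k \<Rightarrow> block_vec (R $ k) (S $ k))"


definition symmetric_matrix :: "'a^'n^'n \<Rightarrow> bool" where
  "symmetric_matrix A \<longleftrightarrow> transpose A = A"

definition positive_definite :: "real^'n^'n \<Rightarrow> bool" where
  "positive_definite A \<longleftrightarrow> symmetric_matrix A \<and> (\<forall>x. x \<noteq> 0 \<longrightarrow> 0 < x \<bullet> (A *v x))"

definition eigenvector :: "'a::field^'n^'n \<Rightarrow> 'a^'n \<Rightarrow> 'a \<Rightarrow> bool" where
  "eigenvector A v l \<longleftrightarrow> v \<noteq> 0 \<and> A *v v = l *s v"

definition eigenvalue :: "'a::field^'n^'n \<Rightarrow> 'a \<Rightarrow> bool" where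
  "eigenvalue A l \<longleftrightarrow> (\<exists>v. eigenvector A v l)"

definition diagonalizable :: "'a::field^'n^'n \<Rightarrow> bool" where
  "diagonalizable A \<longleftrightarrow>
     (\<exists>(P :: 'a^'n^'n) (D :: 'a^'n^'n).
        invertible P \<and> (\<forall>i j. i \<noteq> j \<longrightarrow> D $ i $ j = 0) \<and> A = P ** D ** matrix_inv P)"

text \<open>The eigenvalues of a real matrix are its complex ones, so that their being real is a condition.\<close>

definition diagonalizable_pos :: "real^'n^'n \<Rightarrow> bool" where
  "diagonalizable_pos A \<longleftrightarrow>
     diagonalizable (map_matrix complex_of_real A) \<and>
     (\<forall>l. eigenvalue (map_matrix complex_of_real A) l \<longrightarrow> l \<in> \<real> \<and> 0 < Re l)"

text \<open>The columns of \<open>V\<close> form a basis of right eigenvectors of \<open>A\<close>, with no normalization.\<close>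

definition eigenvector_matrix :: "real^'n^'n \<Rightarrow> real^'n^'n \<Rightarrow> bool" where
  "eigenvector_matrix A V \<longleftrightarrow> invertible V \<and> (\<forall>j. \<exists>l. eigenvector A (column j V) l)"

definition weighted_norm :: "real^'n^'n \<Rightarrow> real^'n \<Rightarrow> real" where
  "weighted_norm P u = sqrt (u \<bullet> (P *v u))"

definition weighted_ball :: "real^'n^'n \<Rightarrow> real^'n \<Rightarrow> real \<Rightarrow> (real^'n) set" where
  "weighted_ball P c \<rho> = {u. weighted_norm P (u - c) < \<rho>}"


text \<open>
  Player \<open>i\<close> has the cost \<open>J\<^sub>i u = 1/2 * (u \<bullet> (M\<^sub>i *v u)) + c\<^sub>i \<bullet> u\<close> with \<open>M\<^sub>i\<close>, \<open>c\<^sub>i\<close>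
  assembled from these blocks.
\<close>

record ('d1, 'd2) quadratic_game =
  A1 :: "real^'d1^'d1"
  B1 :: "real^'d1^'d2"
  D1 :: "real^'d2^'d2"
  A2 :: "real^'d2^'d2"
  B2 :: "real^'d2^'d1"
  D2 :: "real^'d1^'d1"
  a1 :: "real^'d1"
  b1 :: "real^'d2"
  a2 :: "real^'d2"
  b2 :: "real^'d1"

definition M1 :: "('d1::finite, 'd2::finite) quadratic_game \<Rightarrow> real^('d1 + 'd2)^('d1 + 'd2)" where
  "M1 G = block_mat (A1 G) (transpose (B1 G)) (B1 G) (D1 G)"

definition M2 :: "('d1::finite, 'd2::finite) quadratic_game \<Rightarrow> real^('d1 + 'd2)^('d1 + 'd2)" where
  "M2 G = block_mat (D2 G) (B2 G) (transpose (B2 G)) (A2 G)"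

definition c1 :: "('d1::finite, 'd2::finite) quadratic_game \<Rightarrow> real^('d1 + 'd2)" where
  "c1 G = block_vec (a1 G) (b1 G)"

definition c2 :: "('d1::finite, 'd2::finite) quadratic_game \<Rightarrow> real^('d1 + 'd2)" where
  "c2 G = block_vec (b2 G) (a2 G)"

definition nash_mat :: "('d1::finite, 'd2::finite) quadratic_game \<Rightarrow> real^('d1 + 'd2)^('d1 + 'd2)" where
  "nash_mat G = block_mat (A1 G) (B2 G) (B1 G) (A2 G)"

definition altruistic_mat ::
    "('d1::finite, 'd2::finite) quadratic_game \<Rightarrow> real^('d1 + 'd2)^('d1 + 'd2)" where
  "altruistic_mat G = block_mat (D2 G) (transpose (B1 G)) (transpose (B2 G)) (D1 G)"

definition nash_vec :: "('d1::finite, 'd2::finite) quadratic_game \<Rightarrow> real^('d1 + 'd2)" where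
  "nash_vec G = block_vec (a1 G) (a2 G)"

definition altruistic_vec :: "('d1::finite, 'd2::finite) quadratic_game \<Rightarrow> real^('d1 + 'd2)" where
  "altruistic_vec G = block_vec (b2 G) (b1 G)"

definition standing_assumptions :: "('d1::finite, 'd2::finite) quadratic_game \<Rightarrow> bool" where
  "standing_assumptions G \<longleftrightarrow>
     symmetric_matrix (M1 G) \<and> symmetric_matrix (M2 G) \<and>
     positive_definite (A1 G) \<and> positive_definite (A2 G) \<and>
     invertible (M1 G) \<and> invertible (M2 G) \<and>
     invertible (nash_mat G) \<and> invertible (altruistic_mat G)"


text \<open>The solution \<open>u\<close> of the row equation \<open>u\<^sup>T K = - k\<^sup>T\<close>, for invertible \<open>K\<close>.\<close>

definition stationary_point :: "real^'n^'n \<Rightarrow> real^'n \<Rightarrow> real^'n" where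
  "stationary_point K k = - (k v* matrix_inv K)"

definition u_nash :: "('d1::finite, 'd2::finite) quadratic_game \<Rightarrow> real^('d1 + 'd2)" where
  "u_nash G = stationary_point (nash_mat G) (nash_vec G)"

definition u_altruistic :: "('d1::finite, 'd2::finite) quadratic_game \<Rightarrow> real^('d1 + 'd2)" where
  "u_altruistic G = stationary_point (altruistic_mat G) (altruistic_vec G)"

definition u_opt1 :: "('d1::finite, 'd2::finite) quadratic_game \<Rightarrow> real^('d1 + 'd2)" where
  "u_opt1 G = stationary_point (M1 G) (c1 G)"

definition u_opt2 :: "('d1::finite, 'd2::finite) quadratic_game \<Rightarrow> real^('d1 + 'd2)" where
  "u_opt2 G = stationary_point (M2 G) (c2 G)"


definition svo_mat ::
    "('d1::finite, 'd2::finite) quadratic_game \<Rightarrow> real \<Rightarrow> real \<Rightarrow> real^('d1 + 'd2)^('d1 + 'd2)" where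
  "svo_mat G \<theta>1 \<theta>2 = block_mat
     (cos \<theta>1 *\<^sub>R A1 G + sin \<theta>1 *\<^sub>R D2 G)
     (cos \<theta>2 *\<^sub>R B2 G + sin \<theta>2 *\<^sub>R transpose (B1 G))
     (cos \<theta>1 *\<^sub>R B1 G + sin \<theta>1 *\<^sub>R transpose (B2 G))
     (cos \<theta>2 *\<^sub>R A2 G + sin \<theta>2 *\<^sub>R D1 G)"

definition svo_vec ::
    "('d1::finite, 'd2::finite) quadratic_game \<Rightarrow> real \<Rightarrow> real \<Rightarrow> real^('d1 + 'd2)" where
  "svo_vec G \<theta>1 \<theta>2 = block_vec
     (cos \<theta>1 *\<^sub>R a1 G + sin \<theta>1 *\<^sub>R b2 G)
     (cos \<theta>2 *\<^sub>R a2 G + sin \<theta>2 *\<^sub>R b1 G)"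

text \<open>
  At \<open>u_svo G \<theta>1 \<theta>2\<close> the gradient of \<open>cos \<theta>\<^sub>i * J\<^sub>i + sin \<theta>\<^sub>i * J\<^sub>-\<^sub>i\<close> in player \<open>i\<close>'s own
  action vanishes, for both players: the columns of \<open>svo_mat\<close> belonging to player \<open>i\<close> come
  from that gradient.
\<close>

definition u_svo ::
    "('d1::finite, 'd2::finite) quadratic_game \<Rightarrow> real \<Rightarrow> real \<Rightarrow> real^('d1 + 'd2)" where
  "u_svo G \<theta>1 \<theta>2 = stationary_point (svo_mat G \<theta>1 \<theta>2) (svo_vec G \<theta>1 \<theta>2)"


text \<open>The branch of the inverse cotangent with values in \<open>{0<..<pi}\<close>.\<close>

definition arccot :: "real \<Rightarrow> real" where
  "arccot x = pi / 2 - arctan x"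

definition Theta_phi :: "real \<times> real \<Rightarrow> real \<times> real" where
  "Theta_phi = (\<lambda>(\<phi>, t). (arctan (t * cos \<phi>), arctan (t * sin \<phi>)))"

definition Theta_psi :: "real \<times> real \<Rightarrow> real \<times> real" where
  "Theta_psi = (\<lambda>(\<psi>, t). (arctan (t * cos \<psi>), arccot (t * sin \<psi>)))"

definition Theta_dom :: "(real \<times> real) set" where
  "Theta_dom = {0<..<pi/2} \<times> {0<..}"

text \<open>Both maps are bijections from \<open>Theta_dom\<close> onto \<open>{0<..<pi/2} \<times> {0<..<pi/2}\<close>.\<close>

definition phi_of :: "real \<Rightarrow> real \<Rightarrow> real" where
  "phi_of \<theta>1 \<theta>2 = fst (inv_into Theta_dom Theta_phi (\<theta>1, \<theta>2))"

definition psi_of :: "real \<Rightarrow> real \<Rightarrow> real" where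
  "psi_of \<theta>1 \<theta>2 = fst (inv_into Theta_dom Theta_psi (\<theta>1, \<theta>2))"

text \<open>Here \<open>mat k\<close> is \<open>k\<close> times the identity. The same matrix serves for \<open>\<phi>\<close> and for \<open>\<psi>\<close>.\<close>

definition H_mat :: "real \<Rightarrow> real^('d1::finite + 'd2::finite)^('d1 + 'd2)" where
  "H_mat \<phi> = block_mat (mat (cos \<phi>)) 0 0 (mat (sin \<phi>))"

end

theory Submission
  imports Defs
begin

text \<open>
  Let \<open>S\<close>, \<open>s\<close> be the matrix and the vector of the SVO-Nash system. They combine two simpler
  systems, in two ways. Collecting terms by role gives \<open>S = M C + N D\<close> and \<open>s = a C + b D\<close>, where
  \<open>(M, a)\<close> is the Nash system, \<open>(N, b)\<close> the altruistic one, and \<open>C\<close>, \<open>D\<close> scale each player's columns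
  by the cosine and the sine of that player's orientation. Collecting them by cost function gives the
  same form with \<open>(M\<^sub>1, c\<^sub>1)\<close> and \<open>(M\<^sub>2, c\<^sub>2)\<close>, the coefficients of player 2 being swapped. In both
  cases the ratios of the two scalings, \<open>(tan \<theta>\<^sub>1, tan \<theta>\<^sub>2)\<close> or \<open>(tan \<theta>\<^sub>1, cot \<theta>\<^sub>2)\<close>, have polar
  coordinates \<open>t\<close> and \<open>\<phi>\<close> or \<open>\<psi>\<close>, which says \<open>D = t C H\<close>.

  After cancelling \<open>C\<close>, the equation for \<open>u\<close> reads, in row vectors,
  \<open>(u - u\<^sub>N) M = t (u\<^sub>A - u) N H\<close>, that is \<open>(u - u\<^sub>N) K = t (u\<^sub>A - u)\<close> with \<open>K = M H\<^sup>-\<^sup>1 N\<^sup>-\<^sup>1\<close>. Pairing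
  with a right eigenvector of \<open>K\<close> for the eigenvalue \<open>l > 0\<close> decouples it into scalar equations
  \<open>l x = t (d - x)\<close>, where \<open>x\<close> and \<open>d\<close> are the coordinates of \<open>u - u\<^sub>N\<close> and \<open>u\<^sub>A - u\<^sub>N\<close>. Hence \<open>x\<close> lies
  strictly between \<open>0\<close> and \<open>d\<close>, unless \<open>d = 0\<close> and then \<open>x = 0\<close>. The weighted norm is the Euclidean
  norm of these coordinates, and some \<open>d\<close> is nonzero because the radius is positive; so \<open>u\<close> is strictly
  closer to each of \<open>u\<^sub>N\<close>, \<open>u\<^sub>A\<close> than they are to each other. This is
  \<open>stationary_point_in_weighted_balls\<close>; the two decompositions are \<open>svo_eq_nash_altruistic\<close> and
  \<open>svo_eq_individual_optima\<close>.
\<close>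


section \<open>Weighted norms in eigenvector coordinates\<close>

lemma weighted_norm_gram:
  "weighted_norm (V ** transpose V) u = norm (u v* V)"
proof -
  have "u \<bullet> ((V ** transpose V) *v u) = (u v* V) \<bullet> (u v* V)"
    by (simp flip: matrix_vector_mul_assoc dot_lmul_matrix)
  then show ?thesis
    by (simp add: weighted_norm_def norm_eq_sqrt_inner)
qed

lemma weighted_norm_minus_commute:
  "weighted_norm P (u - v) = weighted_norm P (v - u)"
  by (simp add: weighted_norm_def matrix_vector_mult_diff_distrib inner_diff_left inner_diff_right)

lemma vector_matrix_mult_nth:
  fixes w :: "real^'n"
  shows "(w v* V) $ j = w \<bullet> column j V"
  by (simp add: vector_matrix_mult_def column_def inner_vec_def mult.commute)

lemma weighted_norm_less:
  fixes p q :: "real^'n"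
  assumes less: "\<And>j. q \<bullet> column j V \<noteq> 0 \<Longrightarrow> \<bar>p \<bullet> column j V\<bar> < \<bar>q \<bullet> column j V\<bar>"
    and zero: "\<And>j. q \<bullet> column j V = 0 \<Longrightarrow> p \<bullet> column j V = 0"
    and pos: "0 < weighted_norm (V ** transpose V) q"
  shows "weighted_norm (V ** transpose V) p < weighted_norm (V ** transpose V) q"
proof -
  have "q v* V \<noteq> 0"
    using pos by (auto simp: weighted_norm_gram)
  then obtain j where j: "q \<bullet> column j V \<noteq> 0"
    by (auto simp: vec_eq_iff vector_matrix_mult_nth)
  have "(\<Sum>j\<in>UNIV. (p \<bullet> column j V)\<^sup>2) < (\<Sum>j\<in>UNIV. (q \<bullet> column j V)\<^sup>2)"
  proof (rule sum_strict_mono_ex1)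
    show "\<forall>j\<in>UNIV. (p \<bullet> column j V)\<^sup>2 \<le> (q \<bullet> column j V)\<^sup>2"
      using less zero by (metis abs_le_square_iff less_imp_le order_refl)
    show "\<exists>j\<in>UNIV. (p \<bullet> column j V)\<^sup>2 < (q \<bullet> column j V)\<^sup>2"
      using less[OF j] by (meson UNIV_I power2_strict_mono)
  qed simp
  then show ?thesis
    by (simp add: weighted_norm_gram norm_vec_def L2_set_def vector_matrix_mult_nth)
qed

text \<open>
  The hypothesis on the spectrum concerns complex eigenvalues, the columns of \<open>V\<close> are real:
  a real eigenpair is also one of the complexified matrix.
\<close>

lemma eigenvalue_pos:
  assumes "diagonalizable_pos A" and "eigenvector A v l"
  shows "0 < l"
proof -
  let ?v = "\<chi> i. complex_of_real (v $ i)"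
  have Av: "A *v v = l *s v" and "v \<noteq> 0"
    using assms(2) by (auto simp: eigenvector_def)
  have "(\<Sum>j\<in>UNIV. complex_of_real (A $ i $ j) * complex_of_real (v $ j)) =
      complex_of_real l * complex_of_real (v $ i)" for i
    using arg_cong[OF Av, of "\<lambda>w. complex_of_real (w $ i)"]
    by (simp add: matrix_vector_mult_def)
  then have "map_matrix complex_of_real A *v ?v = complex_of_real l *s ?v"
    by (simp add: vec_eq_iff matrix_vector_mult_def map_matrix_def)
  moreover have "?v \<noteq> 0"
    using \<open>v \<noteq> 0\<close> by (simp add: vec_eq_iff)
  ultimately have "eigenvalue (map_matrix complex_of_real A) (complex_of_real l)"
    unfolding eigenvalue_def eigenvector_def by blast
  then show ?thesis
    using assms(1) by (force simp: diagonalizable_pos_def)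
qed


section \<open>Interpolating two stationary points\<close>

lemma matrix_inv_cancel:
  assumes "invertible A"
  shows "A ** matrix_inv A = mat 1" and "matrix_inv A ** A = mat 1"
  using someI_ex[OF assms[unfolded invertible_def]] by (auto simp: matrix_inv_def)

lemma vector_matrix_mult_minus: "(- x) v* A = - (x v* A)" for x :: "real^'n"
  by (simp add: vec_eq_iff vector_matrix_mult_def sum_negf)

lemma vector_matrix_mult_scaleR: "x v* (r *\<^sub>R A) = r *\<^sub>R (x v* A)" for x :: "real^'n"
  by (simp add: vec_eq_iff vector_matrix_mult_def sum_distrib_left mult_ac)

lemma matrix_mult_add_left: "(A + B) ** C = A ** C + B ** C" for A B :: "real^'n^'m"
  by (simp add: vec_eq_iff matrix_matrix_mult_def distrib_right sum.distrib)

lemma vector_matrix_mult_cancel: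
  fixes x y :: "real^'n" and A :: "real^'n^'n"
  assumes "x v* A = y v* A" "invertible A"
  shows "x = y"
  using assms by (metis invertible_def vector_matrix_mul_assoc vector_matrix_mul_rid)

lemma stationary_point_eq_iff:
  assumes "invertible K"
  shows "stationary_point K k = u \<longleftrightarrow> u v* K = - k"
  unfolding stationary_point_def
  by (metis assms matrix_inv_cancel minus_minus vector_matrix_mul_assoc vector_matrix_mul_rid
      vector_matrix_mult_minus)

text \<open>
  In the eigenbasis the matrix is diagonal with entries \<open>l j + t > 0\<close>. Up to invertible factors it is
  the matrix of the interpolating system, which therefore has a unique stationary point.
\<close>

lemma invertible_add_scaled_mat:
  fixes K V :: "real^'n^'n"
  assumes V: "invertible V" and eig: "\<And>j. eigenvector K (column j V) (l j)"
    and pos: "\<And>j. 0 < l j" and "0 \<le> t"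
  shows "invertible (K + t *\<^sub>R mat 1)"
proof -
  define D :: "real^'n^'n" where "D = (\<chi> i j. if i = j then l j + t else 0)"
  have "(K + t *\<^sub>R mat 1) *v column j V = (l j + t) *\<^sub>R column j V" for j
    using eig[of j]
    by (simp add: eigenvector_def matrix_vector_mult_add_rdistrib scalar_mult_eq_scaleR
        scaleR_matrix_vector_assoc[symmetric] scaleR_add_left)
  moreover have "column j (V ** D) = (l j + t) *\<^sub>R column j V" for j
    by (simp add: D_def column_def matrix_matrix_mult_def vec_eq_iff if_distrib mult.commute
        cong: if_cong)
  moreover have "column j ((K + t *\<^sub>R mat 1) ** V) = (K + t *\<^sub>R mat 1) *v column j V" for j
    by (simp add: column_def matrix_matrix_mult_def matrix_vector_mult_def vec_eq_iff)
  ultimately have "(K + t *\<^sub>R mat 1) ** V = V ** D"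
    by (simp add: vec_eq_iff column_def)
  moreover have "det D \<noteq> 0"
    using add_pos_nonneg[OF pos \<open>0 \<le> t\<close>] by (subst det_diagonal) (simp_all add: D_def less_le)
  ultimately have "det (K + t *\<^sub>R mat 1) * det V \<noteq> 0"
    using V by (metis det_mul invertible_det_nz mult_eq_0_iff)
  then show ?thesis
    by (simp add: invertible_det_nz)
qed

text \<open>
  The invertible matrix \<open>E\<close> recombines the equations and leaves the stationary point unchanged.
  In each eigenvector coordinate the new stationary point divides the segment between the two old
  ones in the ratio \<open>t : l\<close>, so both its distances to the ends are proper fractions of the length.
\<close>

lemma stationary_point_in_weighted_balls:
  fixes M N H E V :: "real^'n^'n" and a b :: "real^'n" and t :: real
  defines "K \<equiv> M ** matrix_inv H ** matrix_inv N"
    and "P \<equiv> V ** transpose V"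
    and "u \<equiv> stationary_point M a" and "v \<equiv> stationary_point N b"
    and "w \<equiv> stationary_point ((M + t *\<^sub>R (N ** H)) ** E) ((a + t *\<^sub>R (b v* H)) v* E)"
  assumes M: "invertible M" and N: "invertible N" and H: "invertible H" and E: "invertible E"
    and "0 < t"
    and diag: "diagonalizable_pos K" and V: "eigenvector_matrix K V"
    and radius: "0 < weighted_norm P (v - u)"
  shows "w \<in> weighted_ball P u (weighted_norm P (v - u)) \<inter>
             weighted_ball P v (weighted_norm P (v - u))"
proof -
  obtain l where eig: "\<And>j. eigenvector K (column j V) (l j)"
    using V unfolding eigenvector_matrix_def by metis
  have l_pos: "0 < l j" for j
    using eigenvalue_pos[OF diag eig] .
  have "K ** (N ** H) = M ** (matrix_inv H ** ((matrix_inv N ** N) ** H))"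
    by (simp add: K_def matrix_mul_assoc)
  then have KNH: "K ** (N ** H) = M"
    by (simp add: matrix_inv_cancel N H)
  have S: "M + t *\<^sub>R (N ** H) = (K + t *\<^sub>R mat 1) ** (N ** H)"
    by (simp add: matrix_mult_add_left KNH flip: scalar_matrix_assoc)
  have "invertible ((M + t *\<^sub>R (N ** H)) ** E)"
    unfolding S using invertible_add_scaled_mat[OF _ eig l_pos, of t] V \<open>0 < t\<close> N H E
    by (simp add: eigenvector_matrix_def invertible_mult)
  then have w: "w v* ((M + t *\<^sub>R (N ** H)) ** E) = - ((a + t *\<^sub>R (b v* H)) v* E)"
    using stationary_point_eq_iff w_def by blast
  have a: "a = - (u v* M)" and b: "b = - (v v* N)"
    using stationary_point_eq_iff M N u_def v_def by (metis minus_minus)+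
  have "(w v* (M + t *\<^sub>R (N ** H))) v* E = (- (a + t *\<^sub>R (b v* H))) v* E"
    using w by (metis vector_matrix_mul_assoc vector_matrix_mult_minus)
  then have "w v* (M + t *\<^sub>R (N ** H)) = - (a + t *\<^sub>R (b v* H))"
    using E by (rule vector_matrix_mult_cancel)
  then have "(w v* K + t *\<^sub>R w) v* (N ** H) = (u v* K + t *\<^sub>R v) v* (N ** H)"
    by (simp add: a b vector_matrix_left_distrib vector_matrix_mult_add_rdistrib
        vector_matrix_mult_scaleR scaleR_vector_matrix_assoc vector_matrix_mult_minus
        vector_matrix_mul_assoc KNH)
  then have K_eq: "w v* K + t *\<^sub>R w = u v* K + t *\<^sub>R v"
    using invertible_mult[OF N H] by (rule vector_matrix_mult_cancel)
  have pair: "(x v* K) \<bullet> column j V = l j * (x \<bullet> column j V)" for x j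
    using eig[of j] by (simp add: dot_lmul_matrix eigenvector_def scalar_mult_eq_scaleR)
  have coord: "(l j + t) * ((w - u) \<bullet> column j V) = t * ((v - u) \<bullet> column j V)"
      "(l j + t) * ((w - v) \<bullet> column j V) = - l j * ((v - u) \<bullet> column j V)" for j
    using arg_cong[OF K_eq, of "\<lambda>x. x \<bullet> column j V"]
    by (simp_all add: inner_add_left inner_diff_left pair algebra_simps)
  have shrink: "(d \<noteq> 0 \<longrightarrow> \<bar>x\<bar> < \<bar>d\<bar>) \<and> (d = 0 \<longrightarrow> x = 0)"
    if eq: "(l j + t) * x = c * d" and c: "\<bar>c\<bar> < l j + t" for x d c :: real and j
  proof (intro conjI impI)
    have pos: "0 < l j + t"
      using l_pos[of j] \<open>0 < t\<close> by simp
    show "x = 0" if "d = 0"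
      using eq pos that by simp
    show "\<bar>x\<bar> < \<bar>d\<bar>" if "d \<noteq> 0"
    proof -
      have "(l j + t) * \<bar>x\<bar> = \<bar>c\<bar> * \<bar>d\<bar>"
        using arg_cong[OF eq, of abs] pos by (simp add: abs_mult)
      also have "\<dots> < (l j + t) * \<bar>d\<bar>"
        using c that by simp
      finally show ?thesis
        using pos by simp
    qed
  qed
  have "\<bar>t\<bar> < l j + t" "\<bar>- l j\<bar> < l j + t" for j
    using l_pos[of j] \<open>0 < t\<close> by simp_all
  then have "weighted_norm P (w - u) < weighted_norm P (v - u)"
      "weighted_norm P (w - v) < weighted_norm P (v - u)"
    unfolding P_def
    using shrink coord radius[unfolded P_def] by (metis weighted_norm_less)+
  then show ?thesis
    by (simp add: weighted_ball_def)
qed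


section \<open>Column scalings of block matrices\<close>

definition block_scaling :: "real \<Rightarrow> real \<Rightarrow> real^('d1::finite + 'd2::finite)^('d1 + 'd2)" where
  "block_scaling p q = block_mat (mat p) 0 0 (mat q)"

lemma block_mat_nth [simp]:
  "block_mat P Q R S $ Inl i $ Inl j = P $ i $ j"
  "block_mat P Q R S $ Inl i $ Inr k = Q $ i $ k"
  "block_mat P Q R S $ Inr k $ Inl i = R $ k $ i"
  "block_mat P Q R S $ Inr k $ Inr m = S $ k $ m"
  by (simp_all add: block_mat_def block_vec_def)

lemma block_vec_nth [simp]:
  "block_vec x y $ Inl i = x $ i" "block_vec x y $ Inr k = y $ k"
  by (simp_all add: block_vec_def)

lemma block_scaling_nth:
  "block_scaling p q $ i $ j = (if i = j then case j of Inl _ \<Rightarrow> p | Inr _ \<Rightarrow> q else 0)"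
  by (cases i; cases j) (auto simp: block_scaling_def mat_def)

lemma H_mat_eq_block_scaling: "H_mat \<phi> = block_scaling (cos \<phi>) (sin \<phi>)"
  by (simp add: H_mat_def block_scaling_def)

lemma matrix_mult_block_scaling_nth:
  "(A ** block_scaling p q) $ i $ j = A $ i $ j * (case j of Inl _ \<Rightarrow> p | Inr _ \<Rightarrow> q)"
  by (simp add: matrix_matrix_mult_def block_scaling_nth if_distrib cong: if_cong)

lemma vector_mult_block_scaling_nth:
  "(x v* block_scaling p q) $ j = x $ j * (case j of Inl _ \<Rightarrow> p | Inr _ \<Rightarrow> q)"
  by (simp add: vector_matrix_mult_def block_scaling_nth if_distrib mult.commute cong: if_cong)

lemma invertible_block_scaling:
  assumes "p \<noteq> 0" "q \<noteq> 0"
  shows "invertible (block_scaling p q :: real^('d1::finite + 'd2::finite)^('d1 + 'd2))"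
  using assms
  by (subst invertible_det_nz, subst det_diagonal)
    (auto simp: block_scaling_nth split: sum.split)

text \<open>The factorization \<open>D = t C H\<close>, with \<open>C\<close> pulled out on the right.\<close>

lemma block_scaling_combine:
  fixes M N :: "real^('d1::finite + 'd2::finite)^('d1 + 'd2)" and a b :: "real^('d1 + 'd2)"
  assumes "p * (t * cos \<phi>) = p'" "q * (t * sin \<phi>) = q'"
  shows "M ** block_scaling p q + N ** block_scaling p' q' =
      (M + t *\<^sub>R (N ** H_mat \<phi>)) ** block_scaling p q"
    and "a v* block_scaling p q + b v* block_scaling p' q' =
      (a + t *\<^sub>R (b v* H_mat \<phi>)) v* block_scaling p q"
  using assms
  by (auto simp: vec_eq_iff H_mat_eq_block_scaling matrix_mult_block_scaling_nth
      vector_mult_block_scaling_nth algebra_simps split: sum.split)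

text \<open>
  The columns of player 1 weight \<open>J\<^sub>1\<close> by \<open>cos \<theta>1\<close> and \<open>J\<^sub>2\<close> by \<open>sin \<theta>1\<close>; those of player 2
  weight \<open>J\<^sub>1\<close> by \<open>sin \<theta>2\<close> and \<open>J\<^sub>2\<close> by \<open>cos \<theta>2\<close>. Grouping own against other's cost keeps
  the cosines together; grouping \<open>J\<^sub>1\<close> against \<open>J\<^sub>2\<close> pairs each cosine with a sine.
\<close>

lemma svo_eq_nash_altruistic:
  "svo_mat G \<theta>1 \<theta>2 = nash_mat G ** block_scaling (cos \<theta>1) (cos \<theta>2) +
     altruistic_mat G ** block_scaling (sin \<theta>1) (sin \<theta>2)"
  "svo_vec G \<theta>1 \<theta>2 = nash_vec G v* block_scaling (cos \<theta>1) (cos \<theta>2) +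
     altruistic_vec G v* block_scaling (sin \<theta>1) (sin \<theta>2)"
  by (simp_all add: vec_eq_iff matrix_mult_block_scaling_nth vector_mult_block_scaling_nth
      svo_mat_def svo_vec_def nash_mat_def altruistic_mat_def nash_vec_def altruistic_vec_def
      split_sum_all mult.commute)

lemma svo_eq_individual_optima:
  "svo_mat G \<theta>1 \<theta>2 = M1 G ** block_scaling (cos \<theta>1) (sin \<theta>2) +
     M2 G ** block_scaling (sin \<theta>1) (cos \<theta>2)"
  "svo_vec G \<theta>1 \<theta>2 = c1 G v* block_scaling (cos \<theta>1) (sin \<theta>2) +
     c2 G v* block_scaling (sin \<theta>1) (cos \<theta>2)"
  by (simp_all add: vec_eq_iff matrix_mult_block_scaling_nth vector_mult_block_scaling_nth
      svo_mat_def svo_vec_def M1_def M2_def c1_def c2_def split_sum_all mult.commute)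


section \<open>Polar coordinates for the orientations\<close>

lemma open_quadrant_polar:
  fixes x y :: real
  assumes "0 < x" "0 < y"
  obtains \<phi> t where "(\<phi>, t) \<in> Theta_dom" "t * cos \<phi> = x" "t * sin \<phi> = y"
proof -
  define t where "t = sqrt (x\<^sup>2 + y\<^sup>2)"
  have t: "0 < t" "t\<^sup>2 = x\<^sup>2 + y\<^sup>2"
    using assms by (simp_all add: t_def add_pos_pos)
  have "(x / t)\<^sup>2 + (y / t)\<^sup>2 = 1"
    using t assms by (simp add: power_divide flip: add_divide_distrib)
  then obtain \<phi> where \<phi>: "0 \<le> \<phi>" "\<phi> \<le> pi / 2" "x / t = cos \<phi>" "y / t = sin \<phi>"
    using sincos_total_pi_half[of "x / t" "y / t"] assms t by auto
  \<comment> \<open>At either end of the quarter circle one coordinate would vanish.\<close>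
  have "\<phi> \<noteq> 0" "\<phi> \<noteq> pi / 2"
    using \<phi>(3,4) assms t by (metis cos_pi_half divide_eq_0_iff less_irrefl sin_zero)+
  then have "(\<phi>, t) \<in> Theta_dom"
    using \<phi>(1,2) t by (simp add: Theta_dom_def)
  moreover have "t * cos \<phi> = x" "t * sin \<phi> = y"
    using \<phi>(3,4) t by (simp_all add: field_simps)
  ultimately show ?thesis
    using that by blast
qed

lemma phi_of_polar:
  assumes "\<theta>1 \<in> {0<..<pi/2}" "\<theta>2 \<in> {0<..<pi/2}"
  obtains t where "0 < t" "phi_of \<theta>1 \<theta>2 \<in> {0<..<pi/2}"
    "tan \<theta>1 = t * cos (phi_of \<theta>1 \<theta>2)" "tan \<theta>2 = t * sin (phi_of \<theta>1 \<theta>2)"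
proof -
  obtain \<phi> t where "(\<phi>, t) \<in> Theta_dom" "t * cos \<phi> = tan \<theta>1" "t * sin \<phi> = tan \<theta>2"
    using open_quadrant_polar[of "tan \<theta>1" "tan \<theta>2"] assms by (auto simp: tan_gt_zero)
  then have img: "(\<theta>1, \<theta>2) \<in> Theta_phi ` Theta_dom"
    using assms by (intro image_eqI[of _ _ "(\<phi>, t)"]) (auto simp: Theta_phi_def arctan_tan)
  obtain \<phi>' t' where inv: "inv_into Theta_dom Theta_phi (\<theta>1, \<theta>2) = (\<phi>', t')"
    by fastforce
  have "Theta_phi (\<phi>', t') = (\<theta>1, \<theta>2)" "(\<phi>', t') \<in> Theta_dom"
    using f_inv_into_f[OF img] inv_into_into[OF img] inv by simp_all
  then show ?thesis
    using that[of t'] inv by (auto simp: Theta_phi_def Theta_dom_def phi_of_def tan_arctan)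
qed

lemma psi_of_polar:
  assumes "\<theta>1 \<in> {0<..<pi/2}" "\<theta>2 \<in> {0<..<pi/2}"
  obtains t where "0 < t" "psi_of \<theta>1 \<theta>2 \<in> {0<..<pi/2}"
    "tan \<theta>1 = t * cos (psi_of \<theta>1 \<theta>2)" "cot \<theta>2 = t * sin (psi_of \<theta>1 \<theta>2)"
proof -
  have cot: "tan (pi / 2 - \<theta>2) = cot \<theta>2"
    by (simp add: tan_def cot_def cos_diff sin_diff)
  obtain \<psi> t where "(\<psi>, t) \<in> Theta_dom" "t * cos \<psi> = tan \<theta>1" "t * sin \<psi> = tan (pi / 2 - \<theta>2)"
    using open_quadrant_polar[of "tan \<theta>1" "tan (pi / 2 - \<theta>2)"] assms
    by (auto simp: tan_gt_zero)
  then have img: "(\<theta>1, \<theta>2) \<in> Theta_psi ` Theta_dom"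
    using assms arctan_tan[of "pi / 2 - \<theta>2"]
    by (intro image_eqI[of _ _ "(\<psi>, t)"]) (auto simp: Theta_psi_def arccot_def arctan_tan)
  obtain \<psi>' t' where inv: "inv_into Theta_dom Theta_psi (\<theta>1, \<theta>2) = (\<psi>', t')"
    by fastforce
  have eq: "Theta_psi (\<psi>', t') = (\<theta>1, \<theta>2)" and dom: "(\<psi>', t') \<in> Theta_dom"
    using f_inv_into_f[OF img] inv_into_into[OF img] inv by simp_all
  have "pi / 2 - \<theta>2 = arctan (t' * sin \<psi>')"
    using eq by (auto simp: Theta_psi_def arccot_def)
  then have "cot \<theta>2 = t' * sin \<psi>'"
    using cot by (simp add: tan_arctan)
  then show ?thesis
    using that[of t'] inv eq dom by (auto simp: Theta_psi_def Theta_dom_def psi_of_def tan_arctan)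
qed


section \<open>The SVO-Nash equilibrium\<close>

theorem proposition5:
  fixes G :: "('d1::finite, 'd2::finite) quadratic_game"
    and \<theta>1 \<theta>2 \<phi> \<psi> r r' :: real
    and V\<phi> V\<psi> P\<phi> P\<psi> :: "real^('d1 + 'd2)^('d1 + 'd2)"
  assumes "standing_assumptions G"
    and "\<theta>1 \<in> {0<..<pi/2}" and "\<theta>2 \<in> {0<..<pi/2}"
    and "\<phi> = phi_of \<theta>1 \<theta>2" and "\<psi> = psi_of \<theta>1 \<theta>2"
    and "diagonalizable_pos (nash_mat G ** matrix_inv (H_mat \<phi>) ** matrix_inv (altruistic_mat G))"
    and "eigenvector_matrix (nash_mat G ** matrix_inv (H_mat \<phi>) ** matrix_inv (altruistic_mat G)) V\<phi>"
    and "diagonalizable_pos (M1 G ** matrix_inv (H_mat \<psi>) ** matrix_inv (M2 G))"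
    and "eigenvector_matrix (M1 G ** matrix_inv (H_mat \<psi>) ** matrix_inv (M2 G)) V\<psi>"
    and "P\<phi> = V\<phi> ** transpose V\<phi>" and "P\<psi> = V\<psi> ** transpose V\<psi>"
    and "r = weighted_norm P\<phi> (u_altruistic G - u_nash G)" and "0 < r"
    and "r' = weighted_norm P\<psi> (u_opt1 G - u_opt2 G)" and "0 < r'"
  shows "u_svo G \<theta>1 \<theta>2 \<in>
    weighted_ball P\<phi> (u_nash G) r \<inter> weighted_ball P\<phi> (u_altruistic G) r \<inter>
    weighted_ball P\<psi> (u_opt1 G) r' \<inter> weighted_ball P\<psi> (u_opt2 G) r'"
proof -
  have trig: "cos \<theta>1 > 0" "cos \<theta>2 > 0" "sin \<theta>2 > 0"
    using assms(2,3) by (auto intro!: cos_gt_zero_pi sin_gt_zero)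
  have H: "invertible (H_mat \<alpha> :: real^('d1 + 'd2)^('d1 + 'd2))" if "\<alpha> \<in> {0<..<pi/2}" for \<alpha>
    unfolding H_mat_eq_block_scaling using that
    by (intro invertible_block_scaling) (auto dest: cos_gt_zero sin_gt_zero2)
  have inv: "invertible (M1 G)" "invertible (M2 G)"
      "invertible (nash_mat G)" "invertible (altruistic_mat G)"
    using assms(1) by (auto simp: standing_assumptions_def)

  obtain t where t: "0 < t" "\<phi> \<in> {0<..<pi/2}" "tan \<theta>1 = t * cos \<phi>" "tan \<theta>2 = t * sin \<phi>"
    using phi_of_polar[OF assms(2,3)] assms(4) by metis
  have split_phi: "cos \<theta>1 * (t * cos \<phi>) = sin \<theta>1" "cos \<theta>2 * (t * sin \<phi>) = sin \<theta>2"
    using trig by (simp_all flip: t(3,4) add: tan_def)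
  have "u_svo G \<theta>1 \<theta>2 \<in> weighted_ball P\<phi> (u_nash G) r \<inter> weighted_ball P\<phi> (u_altruistic G) r"
    using stationary_point_in_weighted_balls[OF inv(3,4) H[OF t(2)] invertible_block_scaling t(1)
        assms(6,7), of "cos \<theta>1" "cos \<theta>2" "altruistic_vec G" "nash_vec G"] trig assms(10,12,13)
    by (simp add: u_svo_def svo_eq_nash_altruistic block_scaling_combine[OF split_phi]
        u_nash_def u_altruistic_def)

  moreover obtain t' where t': "0 < t'" "\<psi> \<in> {0<..<pi/2}"
      "tan \<theta>1 = t' * cos \<psi>" "cot \<theta>2 = t' * sin \<psi>"
    using psi_of_polar[OF assms(2,3)] assms(5) by metis
  have split_psi: "cos \<theta>1 * (t' * cos \<psi>) = sin \<theta>1" "sin \<theta>2 * (t' * sin \<psi>) = cos \<theta>2"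
    using trig by (simp_all flip: t'(3,4) add: tan_def cot_def)
  have r': "r' = weighted_norm P\<psi> (u_opt2 G - u_opt1 G)"
    using assms(14) by (simp add: weighted_norm_minus_commute)
  have "u_svo G \<theta>1 \<theta>2 \<in> weighted_ball P\<psi> (u_opt1 G) r' \<inter> weighted_ball P\<psi> (u_opt2 G) r'"
    using stationary_point_in_weighted_balls[OF inv(1,2) H[OF t'(2)] invertible_block_scaling t'(1)
        assms(8,9), of "cos \<theta>1" "sin \<theta>2" "c2 G" "c1 G"] trig assms(11,15) r'
    by (simp add: u_svo_def svo_eq_individual_optima block_scaling_combine[OF split_psi]
        u_opt1_def u_opt2_def)
  ultimately show ?thesis
    by blast
qed

end
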